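(* For every $n\ge1$, $$\sum_{C}\frac{6^n\cdot n!}{|\mathrm{Aut}(C)|}W_C(u,v)=M(n)\,(1+2^n)^{-1}\bigl[2^nu^n+(u+3v)^n\bigr],$$ where the sum is over equivalence classes of self-dual codes of length $n$ and $M(n)=\prod_{i=1}^n(2^i+1)$. For every even $n\ge2$, $$\sum_{C}\frac{6^n\cdot n!}{|\mathrm{Aut}(C)|}W_C(u,v)=M_e(n)\,(1+2^{n-1})^{-1}\Bigl[2^{n-1}u^n+\tfrac12\bigl\{(u+3v)^n+(u-3v)^n\bigr\}\Bigr],$$ where the sum is over equivalence classes of even self-dual codes of length $n$ and $M_e(n)=\prod_{i=0}^{n-1}(2^i+1)$.
   Context: Let $K=\{0,a,b,c\}$ be the Kleinian four-group. A linear code of length $n$ is a subgroup of $K^n$; $\mathrm{wt}(\mathbf{x})$ is the number of nonzero coordinates. Define $x\cdot y\in\mathbb{F}_2$ for $x,y\in K$ by $x\cdot y=1$ iff $x,y$ are nonzero and distinct; $(\mathbf{x},\mathbf{y})=\sum_ix_i\cdot y_i$; $C^\perp=\{\mathbf{x}:(\mathbf{x},\mathbf{y})=0\ \forall \mathbf{y}\in C\}$; $C$ is self-dual if $C=C^\perp$ and even if all codewords have even weight. $W_C(u,v)=\sum_{\mathbf{x}\in C}u^{n-\mathrm{wt}(\mathbf{x})}v^{\mathrm{wt}(\mathbf{x})}$. The group $G=S_3^n\rtimes S_n$ acts on $K^n$ by permuting coordinates and independently permuting $a,b,c$ in each coordinate; equivalence of codes and $\mathrm{Aut}(C)=\{g\in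 G: gC=C\}$ are with respect to $G$. *)

theory Defs
  imports
    "HOL-Algebra.Product_Groups"
    "HOL-Algebra.Sym_Groups"
    "HOL-Algebra.Group_Action"
    "HOL-Library.Z2"
begin

datatype klein = K0 | Ka | Kb | Kc

fun klein_add :: "klein \<Rightarrow> klein \<Rightarrow> klein" where
  "klein_add K0 y = y"
| "klein_add x K0 = x"
| "klein_add Ka Ka = K0" | "klein_add Ka Kb = Kc" | "klein_add Ka Kc = Kb"
| "klein_add Kb Ka = Kc" | "klein_add Kb Kb = K0" | "klein_add Kb Kc = Ka"
| "klein_add Kc Ka = Kb" | "klein_add Kc Kb = Ka" | "klein_add Kc Kc = K0"

definition klein_group :: "klein monoid" where
  "klein_group = \<lparr>carrier = UNIV, monoid.mult = klein_add, one = K0\<rparr>"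

text \<open>Coordinates are indexed by \<open>{1..n}\<close>, to match \<^const>\<open>sym_group\<close>; the elements of the
  product group are extensional functions.\<close>

definition klein_space :: "nat \<Rightarrow> (nat \<Rightarrow> klein) monoid" where
  "klein_space n = product_group {1..n} (\<lambda>_. klein_group)"

definition linear_code :: "nat \<Rightarrow> (nat \<Rightarrow> klein) set \<Rightarrow> bool" where
  "linear_code n C \<longleftrightarrow> subgroup C (klein_space n)"

definition wt :: "nat \<Rightarrow> (nat \<Rightarrow> klein) \<Rightarrow> nat" where
  "wt n x = card {i \<in> {1..n}. x i \<noteq> K0}"

definition klein_dot :: "klein \<Rightarrow> klein \<Rightarrow> bit" where
  "klein_dot x y = (if x \<noteq> K0 \<and> y \<noteq> K0 \<and> x \<noteq> y then 1 else 0)"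

definition code_form :: "nat \<Rightarrow> (nat \<Rightarrow> klein) \<Rightarrow> (nat \<Rightarrow> klein) \<Rightarrow> bit" where
  "code_form n x y = (\<Sum>i\<in>{1..n}. klein_dot (x i) (y i))"

definition dual_code :: "nat \<Rightarrow> (nat \<Rightarrow> klein) set \<Rightarrow> (nat \<Rightarrow> klein) set" where
  "dual_code n C = {x \<in> carrier (klein_space n). \<forall>y\<in>C. code_form n x y = 0}"

definition self_dual_codes :: "nat \<Rightarrow> (nat \<Rightarrow> klein) set set" where
  "self_dual_codes n = {C. linear_code n C \<and> C = dual_code n C}"

definition even_self_dual_codes :: "nat \<Rightarrow> (nat \<Rightarrow> klein) set set" where
  "even_self_dual_codes n = {C \<in> self_dual_codes n. \<forall>x\<in>C. even (wt n x)}"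

definition weight_enumerator ::
    "nat \<Rightarrow> (nat \<Rightarrow> klein) set \<Rightarrow> 'a::comm_semiring_1 \<Rightarrow> 'a \<Rightarrow> 'a" where
  "weight_enumerator n C u v = (\<Sum>x\<in>C. u ^ (n - wt n x) * v ^ wt n x)"

definition S3_group :: "(klein \<Rightarrow> klein) monoid" where
  "S3_group = \<lparr>carrier = {s. s permutes {Ka, Kb, Kc}}, monoid.mult = (\<circ>), one = id\<rparr>"

text \<open>The semidirect product of \<open>S\<^sub>3\<^sup>n\<close> with \<open>S\<^sub>n\<close>. A pair \<open>(s, p)\<close> first moves coordinate
  \<open>j\<close> to \<open>p j\<close> and then applies \<open>s i\<close> in each coordinate \<open>i\<close>.\<close>

definition equiv_group :: "nat \<Rightarrow> ((nat \<Rightarrow> klein \<Rightarrow> klein) \<times> (nat \<Rightarrow> nat)) monoid" where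
  "equiv_group n =
    \<lparr>carrier = carrier (product_group {1..n} (\<lambda>_. S3_group)) \<times> carrier (sym_group n),
     monoid.mult = (\<lambda>(s, p) (t, q). (\<lambda>i\<in>{1..n}. s i \<circ> t (Hilbert_Choice.inv p i), p \<circ> q)),
     one = (\<lambda>i\<in>{1..n}. id, id)\<rparr>"

definition vec_action ::
    "nat \<Rightarrow> (nat \<Rightarrow> klein \<Rightarrow> klein) \<times> (nat \<Rightarrow> nat) \<Rightarrow> (nat \<Rightarrow> klein) \<Rightarrow> nat \<Rightarrow> klein" where
  "vec_action n = (\<lambda>(s, p). \<lambda>x\<in>carrier (klein_space n).
     (\<lambda>i\<in>{1..n}. s i (x (Hilbert_Choice.inv p i))))"

definition code_action ::
    "nat \<Rightarrow> (nat \<Rightarrow> klein \<Rightarrow> klein) \<times> (nat \<Rightarrow> nat) \<Rightarrow> (nat \<Rightarrow> klein) set \<Rightarrow> (nat \<Rightarrow> klein) set" where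
  "code_action n g = (\<lambda>C\<in>Pow (carrier (klein_space n)). vec_action n g ` C)"

definition Aut :: "nat \<Rightarrow> (nat \<Rightarrow> klein) set \<Rightarrow> ((nat \<Rightarrow> klein \<Rightarrow> klein) \<times> (nat \<Rightarrow> nat)) set" where
  "Aut n C = stabilizer (equiv_group n) (code_action n) C"

definition equivalence_classes ::
    "nat \<Rightarrow> (nat \<Rightarrow> klein) set set \<Rightarrow> (nat \<Rightarrow> klein) set set set" where
  "equivalence_classes n S = orbits (equiv_group n) S (code_action n)"

definition mass :: "nat \<Rightarrow> nat" where
  "mass n = (\<Prod>i = 1..n. 2 ^ i + 1)"

definition even_mass :: "nat \<Rightarrow> nat" where
  "even_mass n = (\<Prod>i = 0..n - 1. 2 ^ i + 1)"

lemma group_klein: "group klein_group"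
proof (rule groupI)
  fix x y z assume "x \<in> carrier klein_group"
  show "x \<otimes>\<^bsub>klein_group\<^esub> y \<otimes>\<^bsub>klein_group\<^esub> z = x \<otimes>\<^bsub>klein_group\<^esub> (y \<otimes>\<^bsub>klein_group\<^esub> z)"
    by (cases x; cases y; cases z) (simp_all add: klein_group_def)
  have "klein_add x x = K0" by (cases x) simp_all
  then show "\<exists>y\<in>carrier klein_group. y \<otimes>\<^bsub>klein_group\<^esub> x = \<one>\<^bsub>klein_group\<^esub>"
    by (auto simp: klein_group_def)
qed (simp_all add: klein_group_def)

lemma group_klein_space: "group (klein_space n)"
  by (simp add: klein_space_def group_klein)

lemma carrier_klein_space: "carrier (klein_space n) = {1..n} \<rightarrow>\<^sub>E UNIV"
  by (simp add: klein_space_def klein_group_def)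

lemma carrier_equiv_group:
  "carrier (equiv_group n) =
    ({1..n} \<rightarrow>\<^sub>E {s. s permutes {Ka, Kb, Kc}}) \<times> {p. p permutes {1..n}}"
  by (simp add: equiv_group_def S3_group_def sym_group_def)

lemma mult_equiv_group:
  "(s, p) \<otimes>\<^bsub>equiv_group n\<^esub> (t, q) =
    (\<lambda>i\<in>{1..n}. s i \<circ> t (Hilbert_Choice.inv p i), p \<circ> q)"
  by (simp add: equiv_group_def)

lemma one_equiv_group: "\<one>\<^bsub>equiv_group n\<^esub> = (\<lambda>i\<in>{1..n}. id, id)"
  by (simp add: equiv_group_def)

lemma inv_permutes_in:
  "p permutes {1..n} \<Longrightarrow> i \<in> {1..n} \<Longrightarrow> Hilbert_Choice.inv p i \<in> {1..n::nat}"
  using permutes_in_image permutes_inv by metis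

lemma group_equiv_group: "group (equiv_group n)"
proof (rule groupI)
  fix g h assume "g \<in> carrier (equiv_group n)" "h \<in> carrier (equiv_group n)"
  then obtain s p t q where *: "g = (s, p)" "h = (t, q)"
      "\<And>i. i \<in> {1..n} \<Longrightarrow> s i permutes {Ka, Kb, Kc}"
      "\<And>i. i \<in> {1..n} \<Longrightarrow> t i permutes {Ka, Kb, Kc}"
      "p permutes {1..n}" "q permutes {1..n}"
    unfolding carrier_equiv_group by (auto simp: PiE_iff)
  show "g \<otimes>\<^bsub>equiv_group n\<^esub> h \<in> carrier (equiv_group n)"
    unfolding *(1,2) mult_equiv_group carrier_equiv_group
    using * inv_permutes_in[OF *(5)]
    by (auto intro!: permutes_compose simp del: atLeastAtMost_iff One_nat_def)
next
  show "\<one>\<^bsub>equiv_group n\<^esub> \<in> carrier (equiv_group n)"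
    by (auto simp: one_equiv_group carrier_equiv_group permutes_id)
next
  fix g h k
  assume "g \<in> carrier (equiv_group n)" "h \<in> carrier (equiv_group n)" "k \<in> carrier (equiv_group n)"
  then obtain s p t q r m where *: "g = (s, p)" "h = (t, q)" "k = (r, m)"
      "p permutes {1..n}" "q permutes {1..n}"
    unfolding carrier_equiv_group by auto
  have "Hilbert_Choice.inv (p \<circ> q) = Hilbert_Choice.inv q \<circ> Hilbert_Choice.inv p"
    using * by (intro o_inv_distrib) (auto dest: permutes_bij)
  then show "g \<otimes>\<^bsub>equiv_group n\<^esub> h \<otimes>\<^bsub>equiv_group n\<^esub> k = g \<otimes>\<^bsub>equiv_group n\<^esub> (h \<otimes>\<^bsub>equiv_group n\<^esub> k)"
    unfolding *(1,2,3) mult_equiv_group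
    using inv_permutes_in[OF *(4)]
    by (auto simp: fun_eq_iff comp_assoc simp del: atLeastAtMost_iff)
next
  fix g assume "g \<in> carrier (equiv_group n)"
  then obtain s p where *: "g = (s, p)" "s \<in> {1..n} \<rightarrow>\<^sub>E {s. s permutes {Ka, Kb, Kc}}"
      "p permutes {1..n}"
    unfolding carrier_equiv_group by auto
  then show "\<one>\<^bsub>equiv_group n\<^esub> \<otimes>\<^bsub>equiv_group n\<^esub> g = g"
    unfolding *(1) one_equiv_group mult_equiv_group
    by (auto simp: fun_eq_iff PiE_iff extensional_def)
  define t where "t = (\<lambda>i\<in>{1..n}. Hilbert_Choice.inv (s (p i)))"
  have in_range: "p i \<in> {1..n}" if "i \<in> {1..n}" for i
    using permutes_in_image[OF *(3)] that by blast
  have "(t, Hilbert_Choice.inv p) \<in> carrier (equiv_group n)"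
    unfolding carrier_equiv_group t_def using * in_range
    by (auto simp: PiE_iff permutes_inv simp del: atLeastAtMost_iff)
  moreover have "Hilbert_Choice.inv (s (p i)) \<circ> s (p i) = id" if "i \<in> {1..n}" for i
    using * in_range[OF that] by (auto simp: PiE_iff intro: permutes_inv_o)
  then have "(t, Hilbert_Choice.inv p) \<otimes>\<^bsub>equiv_group n\<^esub> g = \<one>\<^bsub>equiv_group n\<^esub>"
    unfolding *(1) one_equiv_group mult_equiv_group t_def
    using permutes_inv_o[OF *(3)] permutes_inv_inv[OF *(3)]
    by (auto simp: fun_eq_iff simp del: atLeastAtMost_iff)
  ultimately show "\<exists>h\<in>carrier (equiv_group n). h \<otimes>\<^bsub>equiv_group n\<^esub> g = \<one>\<^bsub>equiv_group n\<^esub>"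
    by blast
qed

lemma vec_action_closed:
  "x \<in> carrier (klein_space n) \<Longrightarrow> vec_action n g x \<in> carrier (klein_space n)"
  by (cases g) (auto simp: vec_action_def carrier_klein_space)

lemma vec_action_one:
  "x \<in> carrier (klein_space n) \<Longrightarrow> vec_action n \<one>\<^bsub>equiv_group n\<^esub> x = x"
  by (auto simp: vec_action_def carrier_klein_space one_equiv_group fun_eq_iff PiE_iff extensional_def)

lemma vec_action_mult:
  assumes "g \<in> carrier (equiv_group n)" "h \<in> carrier (equiv_group n)"
    and x: "x \<in> carrier (klein_space n)"
  shows "vec_action n (g \<otimes>\<^bsub>equiv_group n\<^esub> h) x = vec_action n g (vec_action n h x)"
proof -
  obtain s p t q where *: "g = (s, p)" "h = (t, q)" "p permutes {1..n}" "q permutes {1..n}"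
    using assms unfolding carrier_equiv_group by auto
  have "Hilbert_Choice.inv (p \<circ> q) = Hilbert_Choice.inv q \<circ> Hilbert_Choice.inv p"
    using * by (intro o_inv_distrib) (auto dest: permutes_bij)
  then show ?thesis
    using x vec_action_closed[OF x, of h] inv_permutes_in[OF *(3)]
    unfolding *(1,2) mult_equiv_group
    by (auto simp: vec_action_def fun_eq_iff simp del: atLeastAtMost_iff)
qed

lemma group_actionI:
  assumes G: "group G"
    and ext: "\<And>g. g \<in> carrier G \<Longrightarrow> \<phi> g \<in> extensional E"
    and closed: "\<And>g x. g \<in> carrier G \<Longrightarrow> x \<in> E \<Longrightarrow> \<phi> g x \<in> E"
    and one: "\<And>x. x \<in> E \<Longrightarrow> \<phi> \<one>\<^bsub>G\<^esub> x = x"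
    and mult: "\<And>g h x. g \<in> carrier G \<Longrightarrow> h \<in> carrier G \<Longrightarrow> x \<in> E \<Longrightarrow>
                 \<phi> (g \<otimes>\<^bsub>G\<^esub> h) x = \<phi> g (\<phi> h x)"
  shows "group_action G E \<phi>"
proof -
  interpret group G by (rule G)
  have "bij_betw (\<phi> g) E E" if g: "g \<in> carrier G" for g
  proof (rule bij_betw_byWitness[where f' = "\<phi> (inv\<^bsub>G\<^esub> g)"])
    show "\<forall>x\<in>E. \<phi> (inv\<^bsub>G\<^esub> g) (\<phi> g x) = x" "\<forall>x\<in>E. \<phi> g (\<phi> (inv\<^bsub>G\<^esub> g) x) = x"
      using g by (auto simp flip: mult simp: one)
  qed (use g closed in auto)
  then have bij: "\<phi> g \<in> Bij E" if "g \<in> carrier G" for g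
    using that ext by (auto simp: Bij_def)
  have "\<phi> (g \<otimes>\<^bsub>G\<^esub> h) = compose E (\<phi> g) (\<phi> h)" if "g \<in> carrier G" "h \<in> carrier G" for g h
    using that ext[of "g \<otimes>\<^bsub>G\<^esub> h"] mult
    by (intro extensionalityI[of _ E]) (auto simp: compose_def)
  then have "\<phi> \<in> hom G (BijGroup E)"
    using bij by (auto simp: hom_def BijGroup_def)
  then show ?thesis
    by (simp add: group_action_def group_hom_def group_hom_axioms_def G group_BijGroup)
qed

lemma group_action_vec_action:
  "group_action (equiv_group n) (carrier (klein_space n)) (vec_action n)"
  by (rule group_actionI[OF group_equiv_group])
     (auto simp: vec_action_closed vec_action_one vec_action_mult,
      auto simp: vec_action_def)

lemma group_action_code_action:
  "group_action (equiv_group n) (Pow (carrier (klein_space n))) (code_action n)"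
proof (rule group_actionI[OF group_equiv_group])
  fix g h C
  assume gh: "g \<in> carrier (equiv_group n)" "h \<in> carrier (equiv_group n)"
    and C: "C \<in> Pow (carrier (klein_space n))"
  have "vec_action n h ` C \<in> Pow (carrier (klein_space n))"
    using C by (auto intro!: vec_action_closed)
  moreover have "vec_action n (g \<otimes>\<^bsub>equiv_group n\<^esub> h) ` C = vec_action n g ` vec_action n h ` C"
    unfolding image_image using C vec_action_mult[OF gh] by (intro image_cong) auto
  ultimately show "code_action n (g \<otimes>\<^bsub>equiv_group n\<^esub> h) C = code_action n g (code_action n h C)"
    using C by (simp add: code_action_def)
next
  fix C assume C: "C \<in> Pow (carrier (klein_space n))"
  then have "vec_action n \<one>\<^bsub>equiv_group n\<^esub> ` C = id ` C"
    using vec_action_one by (intro image_cong) auto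
  then show "code_action n \<one>\<^bsub>equiv_group n\<^esub> C = C"
    using C by (simp add: code_action_def)
  show "code_action n g C \<in> Pow (carrier (klein_space n))" for g
    using C by (auto simp: code_action_def intro!: vec_action_closed)
qed (simp add: code_action_def)

end

(* The weighted sum over equivalence classes is a sum over all codes, by orbit-stabilizer, and then,
   after exchanging summations, a sum over vectors x weighted by the number of codes containing x.
   That number is the same for all nonzero admissible x: if (x, y) = 1, the transvection along x + y
   is an isometry exchanging x and y, and in the even case it preserves the weight modulo 2. It is
   computed for x = (0, ..., 0, a), where the codes containing x correspond to the codes of length
   n - 1; since a self-dual code has 2^n elements, double counting gives the recursion for the number
   of codes. In the even case a vector of weight one is not admissible, so the quadratic form
   "weight modulo 2" is first replaced, for n even, by the isometric form "number of coordinates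
   equal to c modulo 2", for which (0, ..., 0, a) is singular. *)

theory Submission
  imports Defs
begin


text \<open>These rules would turn addition and multiplication of bits into bitwise operations.\<close>

declare add_bit_eq_xor [simp del] mult_bit_eq_and [simp del]

section \<open>The symplectic space \<open>K^n\<close> and duals of codes\<close>

abbreviation space :: "nat \<Rightarrow> (nat \<Rightarrow> klein) set" where
  "space n \<equiv> carrier (klein_space n)"

definition vadd :: "nat \<Rightarrow> (nat \<Rightarrow> klein) \<Rightarrow> (nat \<Rightarrow> klein) \<Rightarrow> nat \<Rightarrow> klein" where
  "vadd n x y = (\<lambda>i\<in>{1..n}. klein_add (x i) (y i))"

definition vzero :: "nat \<Rightarrow> nat \<Rightarrow> klein" where
  "vzero n = (\<lambda>i\<in>{1..n}. K0)"

lemma UNIV_klein: "UNIV = {K0, Ka, Kb, Kc}"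
  by (auto intro: klein.exhaust)

lemma finite_space: "finite (space n)"
  by (simp add: carrier_klein_space finite_PiE UNIV_klein)

lemma card_space: "card (space n) = 4 ^ n"
proof -
  have "card (UNIV :: klein set) = 4"
    by (simp add: UNIV_klein)
  then show ?thesis
    by (simp add: carrier_klein_space card_PiE)
qed

lemma space_eqI: "x \<in> space n \<Longrightarrow> y \<in> space n \<Longrightarrow> (\<And>i. i \<in> {1..n} \<Longrightarrow> x i = y i) \<Longrightarrow> x = y"
  unfolding carrier_klein_space by (rule PiE_ext)

lemma vadd_closed [simp]: "vadd n x y \<in> space n"
  by (auto simp: vadd_def carrier_klein_space)

lemma vzero_closed [simp]: "vzero n \<in> space n"
  by (auto simp: vzero_def carrier_klein_space)

lemma vadd_apply: "i \<in> {1..n} \<Longrightarrow> vadd n x y i = klein_add (x i) (y i)"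
  by (simp add: vadd_def)

lemma klein_add_self [simp]: "klein_add x x = K0"
  by (cases x) simp_all

lemma klein_add_left_cancel [simp]: "klein_add x (klein_add x y) = y"
  by (cases x; cases y) simp_all

lemma klein_add_right_cancel [simp]: "klein_add (klein_add x y) y = x"
  by (cases x; cases y) simp_all

lemma klein_add_0_right [simp]: "klein_add x K0 = x"
  by (cases x) simp_all

lemma vadd_left_cancel: "y \<in> space n \<Longrightarrow> vadd n x (vadd n x y) = y"
  by (rule space_eqI[of _ n]) (simp_all only: vadd_closed vadd_apply klein_add_left_cancel)

lemma vadd_right_cancel: "x \<in> space n \<Longrightarrow> vadd n (vadd n x y) y = x"
  by (rule space_eqI[of _ n]) (simp_all only: vadd_closed vadd_apply klein_add_right_cancel)

lemma vadd_self: "vadd n x x = vzero n"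
  by (simp add: vadd_def vzero_def)

lemma klein_dot_add: "klein_dot (klein_add x y) z = klein_dot x z + klein_dot y z"
  by (cases x; cases y; cases z) (simp_all add: klein_dot_def)

lemma klein_dot_commute: "klein_dot x y = klein_dot y x"
  by (simp add: klein_dot_def)

lemma code_form_commute: "code_form n x y = code_form n y x"
  by (simp add: code_form_def klein_dot_commute)

lemma code_form_add_left: "code_form n (vadd n x y) z = code_form n x z + code_form n y z"
  by (simp add: code_form_def vadd_def klein_dot_add sum.distrib)

lemma code_form_add_right: "code_form n z (vadd n x y) = code_form n z x + code_form n z y"
  by (metis code_form_add_left code_form_commute)

lemma code_form_self [simp]: "code_form n x x = 0"
  by (simp add: code_form_def klein_dot_def)

lemma code_form_zero [simp]: "code_form n (vzero n) y = 0" "code_form n y (vzero n) = 0"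
  by (simp_all add: code_form_def vzero_def klein_dot_def)

text \<open>A nonzero element of \<open>K\<close> pairs to 1 with some other nonzero element, so a
  vector supported on one nonzero coordinate of \<open>x\<close> suffices.\<close>

lemma code_form_nondegenerate:
  assumes x: "x \<in> space n" and "x \<noteq> vzero n"
  obtains y where "y \<in> space n" "code_form n x y = 1"
proof -
  obtain i where i: "i \<in> {1..n}" "x i \<noteq> K0"
    using space_eqI[OF x vzero_closed] assms(2) by (auto simp: vzero_def)
  obtain t where t: "klein_dot (x i) t = 1"
    using i(2) by (metis klein_dot_def klein.distinct(1,3,5,7,9))
  define y where "y = (\<lambda>j\<in>{1..n}. if j = i then t else K0)"
  have "code_form n x y = (\<Sum>j\<in>{1..n}. if j = i then klein_dot (x i) t else 0)"
    unfolding code_form_def by (rule sum.cong) (auto simp: y_def klein_dot_def)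
  also have "\<dots> = 1"
    using i t by (simp add: sum.delta)
  finally show ?thesis
    by (intro that[of y]) (auto simp: y_def carrier_klein_space)
qed

lemma dual_subset: "dual_code n C \<subseteq> space n"
  by (auto simp: dual_code_def)

lemma dual_zero: "vzero n \<in> dual_code n C"
  by (simp add: dual_code_def)

lemma dual_add: "x \<in> dual_code n C \<Longrightarrow> y \<in> dual_code n C \<Longrightarrow> vadd n x y \<in> dual_code n C"
  by (simp add: dual_code_def code_form_add_left)

lemma linear_code_dual: "linear_code n (dual_code n C)"
proof -
  interpret group "klein_space n" by (rule group_klein_space)
  have mult: "x \<otimes>\<^bsub>klein_space n\<^esub> y = vadd n x y" for x y
    by (simp add: klein_space_def vadd_def klein_group_def)
  have one: "\<one>\<^bsub>klein_space n\<^esub> = vzero n"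
    by (simp add: klein_space_def vzero_def klein_group_def)
  have "inv\<^bsub>klein_space n\<^esub> x = x" if "x \<in> space n" for x
    using that by (intro inv_equality) (simp_all add: mult one vadd_self)
  then show ?thesis
    unfolding linear_code_def
    using dual_zero[of n C] dual_add[of _ n C] dual_subset[of n C]
    by (intro subgroupI) (auto simp: mult subset_iff)
qed

text \<open>Any dual is a subgroup, so the fixed-point equation already forces linearity; later
  arguments check only this equation.\<close>

lemma self_dual_codes_eq: "self_dual_codes n = {C. dual_code n C = C}"
proof -
  have "linear_code n C" if "dual_code n C = C" for C
    using that linear_code_dual by metis
  then show ?thesis by (auto simp: self_dual_codes_def)
qed

section \<open>Character sums and the size of a self-dual code\<close>

definition sgn_bit :: "bit \<Rightarrow> int" where
  "sgn_bit b = (if b = 0 then 1 else -1)"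

lemma sgn_bit_add: "sgn_bit (a + b) = sgn_bit a * sgn_bit b"
  by (cases a; cases b) (simp_all add: sgn_bit_def)

text \<open>Orthogonality of characters: if some \<open>z\<close> in \<open>C\<close> has (x, z) =
  1, translation by \<open>z\<close> permutes \<open>C\<close> and flips every sign, so the sum
  equals its own negative.\<close>

lemma character_sum:
  assumes C: "C \<subseteq> space n" and add: "\<And>y z. y \<in> C \<Longrightarrow> z \<in> C \<Longrightarrow> vadd n y z \<in> C"
    and x: "x \<in> space n"
  shows "(\<Sum>y\<in>C. sgn_bit (code_form n x y)) = (if x \<in> dual_code n C then int (card C) else 0)"
proof (cases "x \<in> dual_code n C")
  case True
  then show ?thesis by (simp add: dual_code_def sgn_bit_def)
next
  case False
  then obtain z where z: "z \<in> C" "code_form n x z = 1"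
    using x by (auto simp: dual_code_def)
  have "(\<Sum>y\<in>C. sgn_bit (code_form n x y)) = (\<Sum>y\<in>C. sgn_bit (code_form n x (vadd n y z)))"
    by (rule sum.reindex_bij_witness[where i = "\<lambda>y. vadd n y z" and j = "\<lambda>y. vadd n y z"])
      (use add z C in \<open>auto simp: vadd_right_cancel subset_iff\<close>)
  also have "\<dots> = - (\<Sum>y\<in>C. sgn_bit (code_form n x y))"
    unfolding sum_negf[symmetric]
    by (simp add: code_form_add_right sgn_bit_add z) (simp add: sgn_bit_def)
  finally show ?thesis using False by simp
qed

lemma dual_space: "dual_code n (space n) = {vzero n}"
proof -
  have "x = vzero n" if "x \<in> dual_code n (space n)" for x
  proof (rule ccontr)
    assume "x \<noteq> vzero n"
    moreover have "x \<in> space n"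
      using that dual_subset by blast
    ultimately obtain y where "y \<in> space n" "code_form n x y = 1"
      using code_form_nondegenerate by metis
    with that show False by (auto simp: dual_code_def)
  qed
  then show ?thesis using dual_zero by auto
qed

text \<open>The signs over all pairs in \<open>space n\<close> times \<open>C\<close> are summed in
  two orders. For fixed \<open>x\<close> only members of the dual, that is of \<open>C\<close>,
  contribute, which gives the square of \<open>card C\<close>; for fixed \<open>y\<close> only the
  zero vector survives by nondegeneracy, which gives \<open>4 ^ n\<close>.\<close>

lemma card_self_dual:
  assumes "dual_code n C = C"
  shows "card C = 2 ^ n"
proof -
  have sub: "C \<subseteq> space n" and zero: "vzero n \<in> C"
    and add: "\<And>y z. y \<in> C \<Longrightarrow> z \<in> C \<Longrightarrow> vadd n y z \<in> C"
    using assms dual_subset dual_zero dual_add by blast+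
  have fin: "finite C" using sub finite_space finite_subset by blast
  have "(\<Sum>x\<in>space n. \<Sum>y\<in>C. sgn_bit (code_form n x y))
      = (\<Sum>x\<in>space n. if x \<in> C then int (card C) else 0)"
    using character_sum[OF sub add] assms by (intro sum.cong) auto
  also have "\<dots> = int (card C * card C)"
    using sub finite_space by (simp add: sum.If_cases Int_absorb1)
  finally have 1: "(\<Sum>x\<in>space n. \<Sum>y\<in>C. sgn_bit (code_form n x y)) = int (card C * card C)" .
  have "(\<Sum>y\<in>C. \<Sum>x\<in>space n. sgn_bit (code_form n x y))
      = (\<Sum>y\<in>C. \<Sum>x\<in>space n. sgn_bit (code_form n y x))"
    by (subst code_form_commute) (rule refl)
  also have "\<dots> = (\<Sum>y\<in>C. if y = vzero n then int (card (space n)) else 0)"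
    using sub by (intro sum.cong refl, subst character_sum) (auto simp: dual_space)
  also have "\<dots> = 4 ^ n"
    using fin zero by (simp add: card_space sgn_bit_def)
  finally have "(\<Sum>y\<in>C. \<Sum>x\<in>space n. sgn_bit (code_form n x y)) = 4 ^ n" .
  with 1 sum.swap[of "\<lambda>x y. sgn_bit (code_form n x y)" C "space n"]
  have "int (card C * card C) = 4 ^ n" by simp
  then have "card C * card C = 4 ^ n"
    by (metis of_nat_eq_iff of_nat_numeral of_nat_power)
  also have "\<dots> = (2 ^ n) ^ 2"
    by (simp add: power2_eq_square flip: power_mult_distrib)
  finally have "(card C)\<^sup>2 = (2 ^ n)\<^sup>2" by (simp add: power2_eq_square)
  then show ?thesis by simp
qed

section \<open>Isometries\<close>

definition isometry :: "nat \<Rightarrow> ((nat \<Rightarrow> klein) \<Rightarrow> nat \<Rightarrow> klein) \<Rightarrow> bool" where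
  "isometry n f \<longleftrightarrow> bij_betw f (space n) (space n) \<and>
     (\<forall>x\<in>space n. \<forall>y\<in>space n. code_form n (f x) (f y) = code_form n x y)"

text \<open>If \<open>f x = f y\<close>, then \<open>x + y\<close> is orthogonal to the whole space,
  hence zero. An injective self-map of a finite set is bijective.\<close>

lemma isometryI:
  assumes closed: "\<And>x. x \<in> space n \<Longrightarrow> f x \<in> space n"
    and form: "\<And>x y. x \<in> space n \<Longrightarrow> y \<in> space n \<Longrightarrow> code_form n (f x) (f y) = code_form n x y"
  shows "isometry n f"
proof -
  have "inj_on f (space n)"
  proof (rule inj_onI)
    fix x y assume xy: "x \<in> space n" "y \<in> space n" "f x = f y"
    have "code_form n (vadd n x y) z = 0" if z: "z \<in> space n" for z
    proof -
      have "code_form n x z = code_form n y z"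
        using form[OF xy(1) z] form[OF xy(2) z] xy(3) by simp
      then show ?thesis
        by (cases "code_form n y z") (simp_all add: code_form_add_left)
    qed
    then have "vadd n x y \<in> dual_code n (space n)"
      by (simp add: dual_code_def)
    then have "vadd n x y = vadd n y y"
      by (simp add: dual_space vadd_self)
    then show "x = y"
      using vadd_right_cancel[OF xy(1), of y] vadd_right_cancel[OF xy(2), of y] by simp
  qed
  moreover have "f ` space n \<subseteq> space n" using closed by auto
  ultimately have "bij_betw f (space n) (space n)"
    by (simp add: bij_betw_def endo_inj_surj finite_space)
  with form show ?thesis by (simp add: isometry_def)
qed

lemma dual_image:
  assumes f: "isometry n f" and C: "C \<subseteq> space n"
  shows "dual_code n (f ` C) = f ` dual_code n C"
proof -
  have im: "f ` space n = space n" using f by (simp add: isometry_def bij_betw_def)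
  have "f x \<in> dual_code n (f ` C) \<longleftrightarrow> x \<in> dual_code n C" if "x \<in> space n" for x
  proof -
    have "code_form n (f x) (f y) = code_form n x y" if "y \<in> C" for y
      using that f C \<open>x \<in> space n\<close> by (auto simp: isometry_def)
    moreover have "f x \<in> space n" using that im by blast
    ultimately show ?thesis using that by (simp add: dual_code_def)
  qed
  then have "{y \<in> f ` space n. y \<in> dual_code n (f ` C)} = f ` {x \<in> space n. x \<in> dual_code n C}"
    by blast
  then show ?thesis
    unfolding im using dual_subset by (simp add: Collect_conj_eq Int_absorb1)
qed

text \<open>One predicate \<open>Q\<close> covers all self-dual codes, the even ones and those
  totally singular for a quadratic form, so that transport and double counting are done
  once.\<close>

definition codes :: "nat \<Rightarrow> ((nat \<Rightarrow> klein) \<Rightarrow> bool) \<Rightarrow> (nat \<Rightarrow> klein) set set" where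
  "codes n Q = {C \<in> self_dual_codes n. \<forall>x\<in>C. Q x}"

lemma codes_subset: "codes n Q \<subseteq> Pow (space n)"
proof
  fix C assume "C \<in> codes n Q"
  then have "dual_code n C = C" by (simp add: codes_def self_dual_codes_eq)
  then show "C \<in> Pow (space n)" using dual_subset[of n C] by simp
qed

lemma finite_codes: "finite (codes n Q)"
  using codes_subset by (rule finite_subset) (simp add: finite_space)

text \<open>Taking duals commutes with an isometry, so self-duality is preserved in both directions;
  the hypothesis on \<open>Q\<close> and \<open>Q'\<close> carries the remaining condition
  along.\<close>

lemma codes_image:
  assumes f: "isometry n f" and Q: "\<And>x. x \<in> space n \<Longrightarrow> Q' (f x) \<longleftrightarrow> Q x"
  shows "bij_betw (image f) (codes n Q) (codes n Q')"
proof -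
  have bij: "bij_betw (image f) (Pow (space n)) (Pow (space n))"
    using f by (simp add: isometry_def bij_betw_Pow)
  have iff: "f ` C \<in> codes n Q' \<longleftrightarrow> C \<in> codes n Q" if C: "C \<in> Pow (space n)" for C
  proof -
    have "C \<subseteq> space n" using C by simp
    have "inj_on f (space n)" using f by (simp add: isometry_def bij_betw_def)
    then have "dual_code n (f ` C) = f ` C \<longleftrightarrow> dual_code n C = C"
      unfolding dual_image[OF f \<open>C \<subseteq> space n\<close>]
      using dual_subset \<open>C \<subseteq> space n\<close> by (rule inj_on_image_eq_iff)
    moreover have "(\<forall>y\<in>f ` C. Q' y) \<longleftrightarrow> (\<forall>x\<in>C. Q x)"
      using Q \<open>C \<subseteq> space n\<close> by (simp add: subset_iff)
    ultimately show ?thesis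
      by (simp only: codes_def self_dual_codes_eq mem_Collect_eq)
  qed
  show ?thesis
    unfolding bij_betw_def
  proof
    show "inj_on (image f) (codes n Q)"
      using bij codes_subset by (rule bij_betw_imp_inj_on[THEN inj_on_subset])
    show "image f ` codes n Q = codes n Q'"
    proof
      show "image f ` codes n Q \<subseteq> codes n Q'"
        using iff codes_subset by blast
      show "codes n Q' \<subseteq> image f ` codes n Q"
      proof
        fix D assume D: "D \<in> codes n Q'"
        then have "D \<in> image f ` Pow (space n)"
          using codes_subset[of n Q'] by (auto simp: bij_betw_imp_surj_on[OF bij])
        with D iff show "D \<in> image f ` codes n Q" by blast
      qed
    qed
  qed
qed

lemma card_codes_image:
  assumes "isometry n f" and "\<And>x. x \<in> space n \<Longrightarrow> Q' (f x) \<longleftrightarrow> Q x"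
  shows "card (codes n Q) = card (codes n Q')"
  by (rule bij_betw_same_card[OF codes_image[where Q = Q and Q' = Q', OF assms]])

lemma card_codes_through_image:
  assumes f: "isometry n f" and Q: "\<And>x. x \<in> space n \<Longrightarrow> Q' (f x) \<longleftrightarrow> Q x" and x: "x \<in> space n"
  shows "card {C \<in> codes n Q. x \<in> C} = card {C \<in> codes n Q'. f x \<in> C}"
proof -
  have bij: "bij_betw (image f) (codes n Q) (codes n Q')"
    by (rule codes_image[where Q = Q and Q' = Q', OF f Q])
  have "f x \<in> f ` C \<longleftrightarrow> x \<in> C" if "C \<in> codes n Q" for C
  proof (rule inj_on_image_mem_iff)
    show "inj_on f (space n)" using f by (simp add: isometry_def bij_betw_def)
    show "C \<subseteq> space n" using that codes_subset by blast
  qed (rule x)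
  then have "image f ` {C \<in> codes n Q. x \<in> C} = {D \<in> image f ` codes n Q. f x \<in> D}"
    by blast
  then have "bij_betw (image f) {C \<in> codes n Q. x \<in> C} {D \<in> codes n Q'. f x \<in> D}"
    using bij inj_on_subset[of "image f" "codes n Q" "{C \<in> codes n Q. x \<in> C}"]
    by (simp add: bij_betw_def Collect_subset)
  then show ?thesis by (rule bij_betw_same_card)
qed

section \<open>Transvections and transitivity\<close>

definition transvection :: "nat \<Rightarrow> (nat \<Rightarrow> klein) \<Rightarrow> (nat \<Rightarrow> klein) \<Rightarrow> nat \<Rightarrow> klein" where
  "transvection n a z = (if code_form n z a = 1 then vadd n z a else z)"

lemma isometry_transvection: "isometry n (transvection n a)"
proof (rule isometryI)
  fix x y
  show "code_form n (transvection n a x) (transvection n a y) = code_form n x y"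
    by (cases "code_form n x a"; cases "code_form n y a"; cases "code_form n x y")
      (simp_all add: transvection_def code_form_add_left code_form_add_right
        code_form_commute[of n a x] code_form_commute[of n a y])
qed (auto simp: transvection_def)

text \<open>For \<open>e = 0\<close> every vector is singular, so the parameter treats all codes and the codes that are
  totally singular for the hyperbolic form at the same time.\<close>

definition qform :: "bit \<Rightarrow> nat \<Rightarrow> (nat \<Rightarrow> klein) \<Rightarrow> bit" where
  "qform e n x = (\<Sum>i\<in>{1..n}. if x i = Kc then e else 0)"

abbreviation singular :: "bit \<Rightarrow> nat \<Rightarrow> (nat \<Rightarrow> klein) \<Rightarrow> bool" where
  "singular e n x \<equiv> qform e n x = 0"

text \<open>For \<open>e = 1\<close> the indicator of \<open>c\<close> on \<open>K\<close> is the
  product of the two coordinates in the basis a, b: a hyperbolic plane whose polar form is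
  \<open>klein_dot\<close>.\<close>

lemma qform_add: "qform e n (vadd n x y) = qform e n x + qform e n y + e * code_form n x y"
proof -
  have "(if klein_add s t = Kc then e else 0)
      = (if s = Kc then e else 0) + (if t = Kc then e else 0) + e * klein_dot s t" for s t
    by (cases s; cases t; cases e) (simp_all add: klein_dot_def)
  then show ?thesis
    by (simp add: qform_def code_form_def vadd_apply sum.distrib sum_distrib_left)
qed

lemma qform_zero [simp]: "qform e n (vzero n) = 0"
  by (simp add: qform_def vzero_def)

lemma qform_0: "qform 0 n x = 0"
  by (simp add: qform_def)

lemma codes_through_step:
  assumes x: "x \<in> space n" "singular e n x" and y: "y \<in> space n" "singular e n y"
    and xy: "code_form n x y = 1"
  shows "card {C \<in> codes n (singular e n). x \<in> C} = card {C \<in> codes n (singular e n). y \<in> C}"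
proof -
  define a where "a = vadd n x y"
  \<comment> \<open>This value makes the transvection preserve the form: when (z, a) = 1, adding
    \<open>a\<close> changes \<open>qform e n z\<close> by
    \<open>qform e n a + e = e + e = 0\<close>.\<close>
  have "qform e n a = e"
    using x y xy by (simp add: a_def qform_add)
  then have q: "qform e n (transvection n a z) = qform e n z" for z
    by (cases "code_form n z a") (simp_all add: transvection_def qform_add)
  \<comment> \<open>Here (x, a) = (x, x) + (x, y) = 1, so \<open>x\<close> goes to x + (x + y) =
    y.\<close>
  have "transvection n a x = y"
    using xy y by (simp add: transvection_def a_def code_form_add_right vadd_left_cancel)
  then show ?thesis
    using card_codes_through_image[OF isometry_transvection, of n "singular e n" a "singular e n" x]
    by (simp only: q x(1))
qed

text \<open>A single transvection handles non-orthogonal vectors. Orthogonal ones are linked through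
  a singular \<open>w\<close> that is orthogonal to neither.\<close>

lemma codes_through_eq:
  assumes x: "x \<in> space n" "singular e n x" "x \<noteq> vzero n"
    and y: "y \<in> space n" "singular e n y" "y \<noteq> vzero n"
  shows "card {C \<in> codes n (singular e n). x \<in> C} = card {C \<in> codes n (singular e n). y \<in> C}"
proof -
  obtain z1 where z1: "z1 \<in> space n" "code_form n x z1 = 1"
    using code_form_nondegenerate[OF x(1,3)] .
  obtain z2 where z2: "z2 \<in> space n" "code_form n y z2 = 1"
    using code_form_nondegenerate[OF y(1,3)] .
  \<comment> \<open>If neither \<open>z1\<close> nor \<open>z2\<close> works for both vectors, each
    pairs to 0 with the other vector, and their sum works.\<close>
  have "\<exists>z\<in>space n. code_form n x z = 1 \<and> code_form n y z = 1"
  proof (cases "code_form n y z1 = 1 \<or> code_form n x z2 = 1")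
    case True
    then show ?thesis using z1 z2 by blast
  next
    case False
    then have "code_form n x (vadd n z1 z2) = 1 \<and> code_form n y (vadd n z1 z2) = 1"
      using z1 z2 by (simp add: code_form_add_right)
    then show ?thesis using vadd_closed[of n z1 z2] by blast
  qed
  then obtain z where z: "z \<in> space n" "code_form n x z = 1" "code_form n y z = 1" by blast
  show ?thesis
  proof (cases "code_form n x y = 1")
    case True
    then show ?thesis using codes_through_step[OF x(1,2) y(1,2)] by simp
  next
    case False
    then have 1: "code_form n x y = 0" by simp
    \<comment> \<open>If \<open>z\<close> is not singular, then \<open>e = 1\<close> and x + z has
      form value 0 + 1 + 1 = 0. Its pairings with \<open>x\<close> and \<open>y\<close> remain 1,
      because (x, x) = (y, x) = 0.\<close>
    define w where "w = (if singular e n z then z else vadd n x z)"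
    have w: "w \<in> space n \<and> singular e n w \<and> code_form n x w = 1 \<and> code_form n y w = 1"
    proof (cases "singular e n z")
      case True
      then show ?thesis using z by (simp add: w_def)
    next
      case False
      then have "e = 1" by (cases e) (simp_all add: qform_0)
      then show ?thesis
        using False z x(2) 1 by (simp add: w_def qform_add code_form_add_right code_form_commute[of n y x])
    qed
    have "card {C \<in> codes n (singular e n). x \<in> C} = card {C \<in> codes n (singular e n). w \<in> C}"
      using codes_through_step[OF x(1,2)] w by simp
    also have "\<dots> = card {C \<in> codes n (singular e n). y \<in> C}"
      using codes_through_step[where y = w, OF y(1,2)] w by simp
    finally show ?thesis .
  qed
qed


section \<open>Adjoining a coordinate\<close>

definition last_a :: "nat \<Rightarrow> nat \<Rightarrow> klein" where
  "last_a m = (\<lambda>i\<in>{1..Suc m}. if i = Suc m then Ka else K0)"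

definition shorten :: "nat \<Rightarrow> (nat \<Rightarrow> klein) \<Rightarrow> nat \<Rightarrow> klein" where
  "shorten m x = restrict x {1..m}"

definition append0 :: "nat \<Rightarrow> (nat \<Rightarrow> klein) \<Rightarrow> nat \<Rightarrow> klein" where
  "append0 m x = x(Suc m := K0)"

text \<open>The direct sum of \<open>D\<close> with {0, a}, which is a self-dual code of length
  one.\<close>

definition extend_code :: "nat \<Rightarrow> (nat \<Rightarrow> klein) set \<Rightarrow> (nat \<Rightarrow> klein) set" where
  "extend_code m D = {x \<in> space (Suc m). x (Suc m) \<in> {K0, Ka} \<and> shorten m x \<in> D}"

lemma atLeastAtMost_Suc: "{1..Suc m} = insert (Suc m) {1..m}"
  by auto

lemma code_form_Suc:
  "code_form (Suc m) x y = code_form m (shorten m x) (shorten m y) + klein_dot (x (Suc m)) (y (Suc m))"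
  unfolding code_form_def atLeastAtMost_Suc by (simp add: shorten_def)

lemma qform_Suc:
  "qform e (Suc m) x = qform e m (shorten m x) + (if x (Suc m) = Kc then e else 0)"
  unfolding qform_def atLeastAtMost_Suc by (simp add: shorten_def add.commute)

lemma last_a_closed: "last_a m \<in> space (Suc m)"
  by (auto simp: last_a_def carrier_klein_space)

lemma last_a_nonzero: "last_a m \<noteq> vzero (Suc m)"
  by (auto simp: last_a_def vzero_def fun_eq_iff)

lemma last_a_Suc: "last_a m (Suc m) = Ka"
  by (simp add: last_a_def)

lemma shorten_last_a: "shorten m (last_a m) = vzero m"
  by (auto simp: shorten_def last_a_def vzero_def fun_eq_iff)

lemma shorten_closed: "shorten m x \<in> space m"
  by (auto simp: shorten_def carrier_klein_space)

lemma append0_closed: "x \<in> space m \<Longrightarrow> append0 m x \<in> space (Suc m)"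
  by (auto simp: append0_def carrier_klein_space PiE_iff extensional_def)

lemma shorten_append0: "x \<in> space m \<Longrightarrow> shorten m (append0 m x) = x"
  by (auto simp: append0_def shorten_def carrier_klein_space PiE_iff extensional_def fun_eq_iff)

lemma append0_Suc: "append0 m x (Suc m) = K0"
  by (simp add: append0_def)

text \<open>Clearing a last coordinate equal to a amounts to adding \<open>last_a m\<close>, an
  operation under which a linear code containing \<open>last_a m\<close> is closed.\<close>

lemma append0_shorten:
  assumes x: "x \<in> space (Suc m)" and "x (Suc m) \<in> {K0, Ka}"
  shows "append0 m (shorten m x) = (if x (Suc m) = K0 then x else vadd (Suc m) x (last_a m))"
proof (rule space_eqI[of _ "Suc m"])
  show "append0 m (shorten m x) \<in> space (Suc m)"
    by (simp add: append0_closed shorten_closed)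
  show "append0 m (shorten m x) i = (if x (Suc m) = K0 then x else vadd (Suc m) x (last_a m)) i"
    if "i \<in> {1..Suc m}" for i
    using that assms(2) by (auto simp: append0_def shorten_def vadd_def last_a_def)
qed (use x in auto)

lemma singular_last_a: "singular e (Suc m) (last_a m)"
  by (simp add: qform_Suc last_a_Suc shorten_last_a)

lemma append0_in_extend_code: "y \<in> space m \<Longrightarrow> y \<in> D \<Longrightarrow> append0 m y \<in> extend_code m D"
  by (simp add: extend_code_def append0_closed append0_Suc shorten_append0)

lemma last_a_in_extend_code: "vzero m \<in> D \<Longrightarrow> last_a m \<in> extend_code m D"
  by (simp add: extend_code_def last_a_closed last_a_Suc shorten_last_a)

lemma klein_dot_Ka_eq_0: "klein_dot x Ka = 0 \<longleftrightarrow> x \<in> {K0, Ka}"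
  by (cases x) (simp_all add: klein_dot_def)

text \<open>Duals of direct sums split. Pairing with \<open>last_a m\<close> confines the last
  coordinate to {0, a}; pairing with the vectors \<open>append0 m y\<close> tests the first
  \<open>m\<close> coordinates.\<close>

lemma dual_extend_code:
  assumes D: "D \<subseteq> space m" "vzero m \<in> D"
  shows "dual_code (Suc m) (extend_code m D) = extend_code m (dual_code m D)"
proof
  show "dual_code (Suc m) (extend_code m D) \<subseteq> extend_code m (dual_code m D)"
  proof
    fix x assume x: "x \<in> dual_code (Suc m) (extend_code m D)"
    then have "code_form (Suc m) x (last_a m) = 0"
      using D last_a_in_extend_code by (auto simp: dual_code_def)
    then have "x (Suc m) \<in> {K0, Ka}"
      by (simp only: code_form_Suc last_a_Suc shorten_last_a code_form_zero klein_dot_Ka_eq_0 add_0)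
    moreover have "code_form m (shorten m x) y = 0" if y: "y \<in> D" for y
    proof -
      have "code_form (Suc m) x (append0 m y) = 0"
        using x y D append0_in_extend_code by (auto simp: dual_code_def)
      then show ?thesis
        using y D by (simp add: code_form_Suc append0_Suc shorten_append0 subset_iff klein_dot_def)
    qed
    ultimately show "x \<in> extend_code m (dual_code m D)"
      using x by (simp add: extend_code_def dual_code_def shorten_closed)
  qed
  show "extend_code m (dual_code m D) \<subseteq> dual_code (Suc m) (extend_code m D)"
    by (auto simp: extend_code_def dual_code_def code_form_Suc klein_dot_def)
qed

lemma extend_code_inject:
  assumes "D \<subseteq> space m" "D' \<subseteq> space m" "extend_code m D = extend_code m D'"
  shows "D = D'"
proof -
  have "y \<in> D \<longleftrightarrow> append0 m y \<in> extend_code m D" if "y \<in> space m" "D \<subseteq> space m" for y D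
    using that by (simp add: extend_code_def append0_closed append0_Suc shorten_append0)
  with assms show ?thesis by blast
qed

text \<open>A self-dual code containing \<open>last_a m\<close> is orthogonal to it, so its last
  coordinates lie in {0, a}; being closed under adding it, the code is a direct sum. The form never
  sees the last coordinate, since a is not c.\<close>

lemma bij_betw_extend_code:
  "bij_betw (extend_code m) (codes m (singular e m))
     {C \<in> codes (Suc m) (singular e (Suc m)). last_a m \<in> C}"
  unfolding bij_betw_def
proof
  show "inj_on (extend_code m) (codes m (singular e m))"
  proof (rule inj_onI)
    fix D D' assume "D \<in> codes m (singular e m)" "D' \<in> codes m (singular e m)"
      and eq: "extend_code m D = extend_code m D'"
    then have "D \<subseteq> space m" "D' \<subseteq> space m" using codes_subset by blast+
    then show "D = D'" using eq by (rule extend_code_inject)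
  qed
  show "extend_code m ` codes m (singular e m) = {C \<in> codes (Suc m) (singular e (Suc m)). last_a m \<in> C}"
  proof (intro equalityI subsetI)
    fix C assume "C \<in> extend_code m ` codes m (singular e m)"
    then obtain D where D: "C = extend_code m D" "dual_code m D = D" "\<forall>x\<in>D. singular e m x"
      by (auto simp: codes_def self_dual_codes_eq)
    have sub: "D \<subseteq> space m" and zero: "vzero m \<in> D"
      using dual_subset[of m D] dual_zero[of m D] unfolding D(2) by blast+
    have "dual_code (Suc m) C = C"
      using dual_extend_code[OF sub zero] D(1,2) by simp
    moreover have "singular e (Suc m) x" if "x \<in> C" for x
      using that D(1,3) by (auto simp: extend_code_def qform_Suc)
    ultimately show "C \<in> {C \<in> codes (Suc m) (singular e (Suc m)). last_a m \<in> C}"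
      using last_a_in_extend_code[OF zero] D(1) by (simp add: codes_def self_dual_codes_eq)
  next
    fix C assume "C \<in> {C \<in> codes (Suc m) (singular e (Suc m)). last_a m \<in> C}"
    then have C: "dual_code (Suc m) C = C" "\<And>x. x \<in> C \<Longrightarrow> singular e (Suc m) x" "last_a m \<in> C"
      by (auto simp: codes_def self_dual_codes_eq)
    have sub: "C \<subseteq> space (Suc m)" and add: "\<And>x y. x \<in> C \<Longrightarrow> y \<in> C \<Longrightarrow> vadd (Suc m) x y \<in> C"
      and zero: "vzero (Suc m) \<in> C"
      using dual_subset[of "Suc m" C] dual_add[of _ "Suc m" C] dual_zero[of "Suc m" C]
      unfolding C(1) by blast+
    \<comment> \<open>The summand is recovered as the subcode with last coordinate 0.\<close>
    define D where "D = {y \<in> space m. append0 m y \<in> C}"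
    have "append0 m (vzero m) = vzero (Suc m)"
      by (rule space_eqI[of _ "Suc m"]) (auto simp: append0_closed, auto simp: append0_def vzero_def)
    then have D: "D \<subseteq> space m" "vzero m \<in> D"
      using zero by (auto simp: D_def)
    have last: "x (Suc m) \<in> {K0, Ka}" if "x \<in> C" for x
    proof -
      have "x \<in> dual_code (Suc m) C" using that C(1) by simp
      then have "code_form (Suc m) x (last_a m) = 0"
        using C(3) by (simp add: dual_code_def)
      then show ?thesis
        by (simp only: code_form_Suc last_a_Suc shorten_last_a code_form_zero klein_dot_Ka_eq_0 add_0)
    qed
    \<comment> \<open>Adding \<open>last_a m\<close> twice returns to \<open>x\<close>, so
      membership passes in both directions.\<close>
    have iff: "append0 m (shorten m x) \<in> C \<longleftrightarrow> x \<in> C"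
      if "x \<in> space (Suc m)" "x (Suc m) \<in> {K0, Ka}" for x
    proof (cases "x (Suc m) = K0")
      case True
      then show ?thesis using append0_shorten[OF that] by simp
    next
      case False
      then have eq: "append0 m (shorten m x) = vadd (Suc m) x (last_a m)"
        using append0_shorten[OF that] by simp
      show ?thesis
        unfolding eq
        using add[OF _ C(3), of x] add[OF _ C(3), of "vadd (Suc m) x (last_a m)"]
        by (auto simp: vadd_right_cancel[OF that(1)])
    qed
    have CD: "C = extend_code m D"
    proof -
      have "x \<in> extend_code m D \<longleftrightarrow>
          x \<in> space (Suc m) \<and> x (Suc m) \<in> {K0, Ka} \<and> append0 m (shorten m x) \<in> C" for x
        by (simp add: extend_code_def D_def shorten_closed)
      then have "x \<in> C \<longleftrightarrow> x \<in> extend_code m D" for x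
        using iff[of x] last[of x] sub by blast
      then show ?thesis by blast
    qed
    \<comment> \<open>Self-duality descends from \<open>C\<close> to \<open>D\<close> by injectivity
      of the extension.\<close>
    have "extend_code m (dual_code m D) = extend_code m D"
      using dual_extend_code[OF D] C(1) CD by simp
    then have "dual_code m D = D"
      by (rule extend_code_inject[OF dual_subset D(1)])
    moreover have "singular e m y" if "y \<in> D" for y
      using that C(2)[of "append0 m y"] by (simp add: D_def qform_Suc append0_Suc shorten_append0)
    ultimately show "C \<in> extend_code m ` codes m (singular e m)"
      by (intro image_eqI[where x = D]) (use CD in \<open>simp_all add: codes_def self_dual_codes_eq\<close>)
  qed
qed

lemma card_codes_through:
  assumes "x \<in> space (Suc m)" "singular e (Suc m) x" "x \<noteq> vzero (Suc m)"
  shows "card {C \<in> codes (Suc m) (singular e (Suc m)). x \<in> C} = card (codes m (singular e m))"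
  using codes_through_eq[OF assms last_a_closed singular_last_a last_a_nonzero]
    bij_betw_same_card[OF bij_betw_extend_code] by metis

section \<open>Counting\<close>

text \<open>After the exchange of summations each admissible vector is weighted by the number of
  codes through it. The zero vector lies in every code, which accounts for its separate
  term.\<close>

lemma sum_codes:
  fixes w :: "(nat \<Rightarrow> klein) \<Rightarrow> 'a :: comm_ring_1"
  assumes through: "\<And>x. x \<in> space n \<Longrightarrow> Q x \<Longrightarrow> x \<noteq> vzero n \<Longrightarrow> card {C \<in> codes n Q. x \<in> C} = c"
    and zero: "Q (vzero n)"
  shows "(\<Sum>C\<in>codes n Q. \<Sum>x\<in>C. w x) =
    of_nat (card (codes n Q)) * w (vzero n) + of_nat c * ((\<Sum>x | x \<in> space n \<and> Q x. w x) - w (vzero n))"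
proof -
  let ?P = "{x \<in> space n. Q x}"
  have fin: "finite ?P" using finite_space by simp
  have z: "{C \<in> codes n Q. vzero n \<in> C} = codes n Q"
    using dual_zero by (auto simp: codes_def self_dual_codes_eq)
  have "(\<Sum>C\<in>codes n Q. \<Sum>x\<in>C. w x) = (\<Sum>C\<in>codes n Q. \<Sum>x | x \<in> ?P \<and> x \<in> C. w x)"
  proof (rule sum.cong[OF refl])
    fix C assume "C \<in> codes n Q"
    then have "C = {x. x \<in> ?P \<and> x \<in> C}" using codes_subset by (auto simp: codes_def)
    then show "sum w C = (\<Sum>x | x \<in> ?P \<and> x \<in> C. w x)" by simp
  qed
  also have "\<dots> = (\<Sum>x\<in>?P. \<Sum>C | C \<in> codes n Q \<and> x \<in> C. w x)"
    by (rule sum.swap_restrict[OF finite_codes fin])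
  also have "\<dots> = (\<Sum>x\<in>?P. of_nat (card {C \<in> codes n Q. x \<in> C}) * w x)"
    by simp
  also have "\<dots> = of_nat (card (codes n Q)) * w (vzero n)
      + (\<Sum>x\<in>?P - {vzero n}. of_nat (card {C \<in> codes n Q. x \<in> C}) * w x)"
    using fin zero z by (simp add: sum.remove[of _ "vzero n"])
  also have "(\<Sum>x\<in>?P - {vzero n}. of_nat (card {C \<in> codes n Q. x \<in> C}) * w x)
      = of_nat c * (\<Sum>x\<in>?P - {vzero n}. w x)"
    unfolding sum_distrib_left using through by (intro sum.cong) auto
  also have "(\<Sum>x\<in>?P - {vzero n}. w x) = (\<Sum>x\<in>?P. w x) - w (vzero n)"
    using fin zero by (simp add: sum_diff1)
  finally show ?thesis .
qed

text \<open>Pairs of a code and one of its members are counted twice: by codes, each with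
  \<open>2 ^ Suc m\<close> elements, and by vectors through \<open>sum_codes\<close> with constant
  weight 1. Moving the contribution of the zero vector to the left leaves the factor
  \<open>2 ^ Suc m - 1\<close>.\<close>

lemma card_codes_Suc:
  "int (card (codes (Suc m) (singular e (Suc m)))) * (2 ^ Suc m - 1) =
     int (card (codes m (singular e m))) * (int (card {x \<in> space (Suc m). singular e (Suc m) x}) - 1)"
proof -
  have "card C = 2 ^ Suc m" if "C \<in> codes (Suc m) (singular e (Suc m))" for C
    using that by (intro card_self_dual) (simp add: codes_def self_dual_codes_eq)
  then have "(\<Sum>C\<in>codes (Suc m) (singular e (Suc m)). \<Sum>x\<in>C. 1 :: int)
      = int (card (codes (Suc m) (singular e (Suc m)))) * 2 ^ Suc m"
    by simp
  moreover note sum_codes[where w = "\<lambda>_. 1 :: int" and n = "Suc m" and Q = "singular e (Suc m)",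
      OF card_codes_through]
  ultimately show ?thesis by (simp add: algebra_simps)
qed

section \<open>Numbers of singular vectors and of codes\<close>

lemma sum_space_prod:
  fixes f :: "klein \<Rightarrow> 'a :: comm_semiring_1"
  shows "(\<Sum>x\<in>space n. \<Prod>i\<in>{1..n}. f (x i)) = (f K0 + f Ka + f Kb + f Kc) ^ n"
proof -
  have "(\<Prod>i\<in>{1..n}. \<Sum>t\<in>UNIV. f t) = (\<Sum>x\<in>space n. \<Prod>i\<in>{1..n}. f (x i))"
    unfolding carrier_klein_space by (rule prod_sum_PiE) (simp_all add: UNIV_klein)
  then show ?thesis by (simp add: UNIV_klein add.assoc)
qed

lemma sgn_bit_sum: "sgn_bit (\<Sum>i\<in>A. f i) = (\<Prod>i\<in>A. sgn_bit (f i))"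
  by (induction A rule: infinite_finite_induct) (simp_all add: sgn_bit_add, simp_all add: sgn_bit_def)

text \<open>The sum of the signs of the form is the number of singular vectors minus the number of
  the others. It factors over the coordinates, each contributing 1 + 1 + 1 - 1 = 2.\<close>

lemma card_singular_hyperbolic: "2 * int (card {x \<in> space n. singular 1 n x}) = 4 ^ n + 2 ^ n"
proof -
  have "(\<Sum>x\<in>space n. sgn_bit (qform 1 n x)) = 2 ^ n"
    unfolding qform_def sgn_bit_sum
    using sum_space_prod[of "\<lambda>t. sgn_bit (if t = Kc then 1 else 0)" n] by (simp add: sgn_bit_def)
  moreover have "(\<Sum>x\<in>space n. sgn_bit (qform 1 n x))
      = (\<Sum>x\<in>space n. 2 * (if singular 1 n x then 1 else 0) - 1)"
    by (rule sum.cong) (auto simp: sgn_bit_def)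
  moreover have "\<dots> = 2 * int (card {x \<in> space n. singular 1 n x}) - 4 ^ n"
    by (simp add: sum_subtractf card_space finite_space flip: sum_distrib_left sum.inter_filter)
  ultimately show ?thesis by simp
qed

lemma card_codes_0: "card (codes 0 (singular e 0)) = 1"
proof -
  have space: "space 0 = {vzero 0}"
    by (auto simp: carrier_klein_space vzero_def)
  have "dual_code 0 C = {vzero 0}" for C
    using dual_subset[of 0 C] dual_zero[of 0 C] space by auto
  then have "codes 0 (singular e 0) = {{vzero 0}}"
    by (auto simp: codes_def self_dual_codes_eq)
  then show ?thesis by simp
qed

text \<open>For \<open>e = 0\<close> all vectors are singular, and \<open>4 ^ Suc m - 1\<close> is
  the product of \<open>2 ^ Suc m - 1\<close>, which cancels, and
  \<open>2 ^ Suc m + 1\<close>.\<close>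

lemma card_codes_symplectic_Suc:
  "card (codes (Suc m) (singular 0 (Suc m))) = (2 ^ Suc m + 1) * card (codes m (singular 0 m))"
proof -
  have "(4::int) ^ Suc m = 2 ^ Suc m * 2 ^ Suc m"
    by (simp flip: power_mult_distrib)
  then have "int (card (codes (Suc m) (singular 0 (Suc m)))) * (2 ^ Suc m - 1)
      = (2 ^ Suc m + 1) * int (card (codes m (singular 0 m))) * (2 ^ Suc m - 1)"
    using card_codes_Suc[of m 0] by (simp add: card_space qform_0 algebra_simps)
  moreover have "(2::int) ^ Suc m - 1 \<noteq> 0"
    using one_less_power[of "2::int" "Suc m"] by simp
  ultimately have "int (card (codes (Suc m) (singular 0 (Suc m))))
      = (2 ^ Suc m + 1) * int (card (codes m (singular 0 m)))"
    by (metis mult_right_cancel)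
  then show ?thesis
    by (metis (mono_tags, lifting) of_nat_1 of_nat_add of_nat_eq_iff of_nat_mult of_nat_numeral of_nat_power)
qed

lemma card_codes_hyperbolic_Suc:
  "card (codes (Suc m) (singular 1 (Suc m))) = (2 ^ m + 1) * card (codes m (singular 1 m))"
proof -
  let ?s = "int (card {x \<in> space (Suc m). singular 1 (Suc m) x})"
  have "(4::int) ^ Suc m = 2 ^ Suc m * 2 ^ Suc m"
    by (simp flip: power_mult_distrib)
  \<comment> \<open>From \<open>2 * ?s = 4 ^ Suc m + 2 ^ Suc m\<close>; the second factor is the one
    that cancels in the recursion.\<close>
  then have s: "?s - 1 = (2 ^ m + 1) * (2 ^ Suc m - 1)"
    using card_singular_hyperbolic[of "Suc m"] by (simp add: algebra_simps)
  have "int (card (codes (Suc m) (singular 1 (Suc m)))) * (2 ^ Suc m - 1)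
      = (2 ^ m + 1) * int (card (codes m (singular 1 m))) * (2 ^ Suc m - 1)"
    unfolding card_codes_Suc[of m 1] s by (simp only: mult_ac)
  moreover have "(2::int) ^ Suc m - 1 \<noteq> 0"
    using one_less_power[of "2::int" "Suc m"] by simp
  ultimately have "int (card (codes (Suc m) (singular 1 (Suc m))))
      = (2 ^ m + 1) * int (card (codes m (singular 1 m)))"
    by (metis mult_right_cancel)
  then show ?thesis
    by (metis (mono_tags, lifting) of_nat_1 of_nat_add of_nat_eq_iff of_nat_mult of_nat_numeral of_nat_power)
qed

lemma card_codes_symplectic: "card (codes n (singular 0 n)) = mass n"
  by (induction n) (simp_all add: card_codes_0 card_codes_symplectic_Suc mass_def)

lemma card_codes_hyperbolic: "card (codes n (singular 1 n)) = (\<Prod>i<n. 2 ^ i + 1)"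
  by (induction n) (simp_all add: card_codes_0 card_codes_hyperbolic_Suc)


section \<open>The weight form in even length\<close>

lemma even_iff_of_nat_bit: "even k \<longleftrightarrow> (of_nat k :: bit) = 0"
proof (induction k)
  case (Suc k)
  then show ?case by (cases "of_nat k :: bit") simp_all
qed simp

lemma wt_eq_sum: "wt n x = (\<Sum>i\<in>{1..n}. if x i \<noteq> K0 then 1 else 0)"
  by (simp add: wt_def sum.If_cases Int_def)

lemma even_wt_iff: "even (wt n x) \<longleftrightarrow> (\<Sum>i\<in>{1..n}. if x i \<noteq> K0 then 1 else 0 :: bit) = 0"
proof -
  have "(of_nat (wt n x) :: bit) = (\<Sum>i\<in>{1..n}. if x i \<noteq> K0 then 1 else 0)"
    unfolding wt_eq_sum of_nat_sum by (rule sum.cong) simp_all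
  then show ?thesis by (simp add: even_iff_of_nat_bit)
qed

fun pair_left :: "klein \<Rightarrow> klein \<Rightarrow> klein" where
  "pair_left s t = klein_add (case s of Ka \<Rightarrow> Ka | Kb \<Rightarrow> Ka | _ \<Rightarrow> K0)
     (case t of K0 \<Rightarrow> K0 | Ka \<Rightarrow> Kb | Kb \<Rightarrow> Kc | Kc \<Rightarrow> Ka)"

fun pair_right :: "klein \<Rightarrow> klein \<Rightarrow> klein" where
  "pair_right s t = klein_add s (case t of Ka \<Rightarrow> Kc | Kb \<Rightarrow> Kc | _ \<Rightarrow> K0)"

text \<open>Two anisotropic planes are isometric to two hyperbolic planes: in each pair of coordinates,
  \<open>(a, 0) \<mapsto> (a, a)\<close>, \<open>(b, 0) \<mapsto> (a, b)\<close>, \<open>(0, a) \<mapsto> (b, c)\<close>, \<open>(0, b) \<mapsto> (c, c)\<close>.\<close>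

definition pair_map :: "nat \<Rightarrow> (nat \<Rightarrow> klein) \<Rightarrow> nat \<Rightarrow> klein" where
  "pair_map n x = (\<lambda>i\<in>{1..n}. if odd i then pair_left (x i) (x (i + 1)) else pair_right (x (i - 1)) (x i))"

lemma klein_dot_pair:
  "klein_dot (pair_left s t) (pair_left s' t') + klein_dot (pair_right s t) (pair_right s' t') =
     klein_dot s s' + klein_dot t t'"
  by (cases s; cases t; cases s'; cases t') (simp_all add: klein_dot_def)

text \<open>On one coordinate the weight form has Arf invariant 1 and the form counting c has 0, so
  no isometry relates them. On two coordinates both invariants vanish, which is why coordinates are
  paired and \<open>n\<close> is even.\<close>

lemma weight_pair:
  "(if pair_left s t \<noteq> K0 then 1 else 0 :: bit) + (if pair_right s t \<noteq> K0 then 1 else 0) =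
     (if s = Kc then 1 else 0) + (if t = Kc then 1 else 0)"
  by (cases s; cases t) simp_all

text \<open>Coordinates start at 1, so the pairs are (2j + 1, 2j + 2) and the left member has odd
  index.\<close>

lemma sum_pairs:
  fixes m :: nat
  shows "(\<Sum>i\<in>{1..2 * m}. f i) = (\<Sum>j<m. f (2 * j + 1) + f (2 * j + 2) :: 'a :: comm_monoid_add)"
  by (induction m) (simp_all add: add.assoc)

lemma pair_map_closed: "pair_map n x \<in> space n"
  by (simp add: pair_map_def carrier_klein_space)

lemma pair_map_pair:
  assumes "j < m"
  shows "pair_map (2 * m) x (2 * j + 1) = pair_left (x (2 * j + 1)) (x (2 * j + 2))"
    and "pair_map (2 * m) x (2 * j + 2) = pair_right (x (2 * j + 1)) (x (2 * j + 2))"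
  using assms by (simp_all add: pair_map_def del: pair_left.simps pair_right.simps)

lemma isometry_pair_map: "isometry (2 * m) (pair_map (2 * m))"
proof (rule isometryI)
  fix x y
  show "code_form (2 * m) (pair_map (2 * m) x) (pair_map (2 * m) y) = code_form (2 * m) x y"
    unfolding code_form_def sum_pairs
    by (rule sum.cong[OF refl]) (simp only: lessThan_iff pair_map_pair klein_dot_pair)
qed (rule pair_map_closed)

lemma even_wt_pair_map: "even (wt (2 * m) (pair_map (2 * m) x)) \<longleftrightarrow> singular 1 (2 * m) x"
proof -
  have "(\<Sum>i\<in>{1..2 * m}. if pair_map (2 * m) x i \<noteq> K0 then 1 else 0 :: bit) = qform 1 (2 * m) x"
    unfolding qform_def sum_pairs
    by (rule sum.cong[OF refl]) (simp only: lessThan_iff pair_map_pair weight_pair)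
  then show ?thesis by (simp only: even_wt_iff)
qed

lemma pair_map_zero: "pair_map n (vzero n) = vzero n" if "even n"
proof (rule space_eqI[of _ n])
  fix i assume "i \<in> {1..n}"
  then show "pair_map n (vzero n) i = vzero n i"
    \<comment> \<open>The index \<open>n\<close> is even and so a right member; hence
      \<open>x (i + 1)\<close> is read only for i < n, inside the range where \<open>vzero n\<close>
      is specified.\<close>
    using that by (cases "i = n") (auto simp: pair_map_def vzero_def)
qed (simp_all add: pair_map_closed)

lemma card_even_codes: "card (codes (2 * m) (\<lambda>x. even (wt (2 * m) x))) = (\<Prod>i<2 * m. 2 ^ i + 1)"
  using card_codes_image[OF isometry_pair_map, where Q = "singular 1 (2 * m)"
      and Q' = "\<lambda>x. even (wt (2 * m) x)"] even_wt_pair_map card_codes_hyperbolic by metis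

text \<open>The vector is pulled back along \<open>pair_map\<close> to a nonzero singular vector.
  The description \<open>2 * m\<close> serves the pairing, and \<open>Suc k\<close> the removal of
  one coordinate.\<close>

lemma card_even_codes_through:
  assumes n: "n = 2 * m" "n = Suc k" and y: "y \<in> space n" "even (wt n y)" "y \<noteq> vzero n"
  shows "card {C \<in> codes n (\<lambda>x. even (wt n x)). y \<in> C} = (\<Prod>i<k. 2 ^ i + 1)"
proof -
  have iso: "isometry n (pair_map n)"
    unfolding n(1) by (rule isometry_pair_map)
  have wt: "even (wt n (pair_map n x)) \<longleftrightarrow> singular 1 n x" for x
    unfolding n(1) by (rule even_wt_pair_map)
  have "y \<in> pair_map n ` space n"
    using iso y(1) by (simp add: isometry_def bij_betw_def)
  then obtain x where x: "x \<in> space n" "y = pair_map n x" by blast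
  have "singular 1 n x" using wt x(2) y(2) by blast
  moreover have "x \<noteq> vzero n"
    using x(2) y(3) pair_map_zero n(1) by auto
  ultimately have "card {C \<in> codes n (singular 1 n). x \<in> C} = (\<Prod>i<k. 2 ^ i + 1)"
    using x(1) card_codes_through[of x k 1] unfolding n(2) card_codes_hyperbolic by blast
  then show ?thesis
    using card_codes_through_image[OF iso, where Q = "singular 1 n" and Q' = "\<lambda>x. even (wt n x)"]
      wt x by simp
qed

section \<open>Weight sums\<close>

lemma wt_zero: "wt n (vzero n) = 0"
  by (simp add: wt_def vzero_def)

text \<open>The monomial becomes a product over coordinates, so that \<open>sum_space_prod\<close>
  applies.\<close>

lemma weight_monomial:
  fixes u v :: "'a :: comm_semiring_1"
  shows "u ^ (n - wt n x) * v ^ wt n x = (\<Prod>i\<in>{1..n}. if x i = K0 then u else v)"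
proof -
  have v: "card ({1..n} \<inter> - {i. x i = K0}) = wt n x"
    by (simp add: wt_def Int_def)
  have "card ({1..n} \<inter> {i. x i = K0}) = card {1..n} - card ({1..n} \<inter> - {i. x i = K0})"
    by (subst card_Diff_subset[symmetric]) (auto intro: arg_cong[where f = card])
  then have "card ({1..n} \<inter> {i. x i = K0}) = n - wt n x"
    unfolding v by simp
  then show ?thesis
    using v by (simp add: prod.If_cases)
qed

lemma sum_weights:
  fixes u v :: "'a :: comm_semiring_1"
  shows "(\<Sum>x\<in>space n. u ^ (n - wt n x) * v ^ wt n x) = (u + 3 * v) ^ n"
proof -
  have "3 * v = (1 + 1 + 1) * v" by simp
  also have "\<dots> = v + v + v" by (simp only: distrib_right mult_1)
  finally show ?thesis
    unfolding weight_monomial using sum_space_prod[of "\<lambda>t. if t = K0 then u else v" n]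
    by (simp add: add.assoc)
qed

text \<open>Averaging the full sum over \<open>v\<close> and \<open>- v\<close> cancels the odd
  weights.\<close>

lemma sum_even_weights:
  fixes u v :: "'a :: field_char_0"
  shows "(\<Sum>x | x \<in> space n \<and> even (wt n x). u ^ (n - wt n x) * v ^ wt n x) =
    1 / 2 * ((u + 3 * v) ^ n + (u - 3 * v) ^ n)"
proof -
  let ?w = "\<lambda>v x. u ^ (n - wt n x) * v ^ wt n x"
  have "(u + 3 * v) ^ n + (u - 3 * v) ^ n = (\<Sum>x\<in>space n. ?w v x + ?w (- v) x)"
    using sum_weights[of u n v] sum_weights[of u n "- v"] by (simp add: sum.distrib)
  also have "\<dots> = (\<Sum>x\<in>space n. if even (wt n x) then 2 * ?w v x else 0)"
    by (rule sum.cong) auto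
  also have "\<dots> = (\<Sum>x | x \<in> space n \<and> even (wt n x). 2 * ?w v x)"
    by (simp add: finite_space flip: sum.inter_filter)
  also have "\<dots> = 2 * (\<Sum>x | x \<in> space n \<and> even (wt n x). ?w v x)"
    by (simp add: sum_distrib_left)
  finally show ?thesis by simp
qed

section \<open>Summation over equivalence classes\<close>

text \<open>By the orbit-stabilizer theorem the coefficient is the size of the orbit, on which
  \<open>f\<close> is constant; summing over the orbits, which partition \<open>S\<close>, gives the
  sum over \<open>S\<close>. Any choice of representatives is allowed.\<close>

lemma (in group_action) sum_orbit_representatives:
  fixes f :: "'c \<Rightarrow> 'd :: field_char_0"
  assumes fin: "finite (carrier G)" "finite S" and S: "S \<subseteq> E"
    and closed: "\<And>g x. g \<in> carrier G \<Longrightarrow> x \<in> S \<Longrightarrow> \<phi> g x \<in> S"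
    and inv: "\<And>g x. g \<in> carrier G \<Longrightarrow> x \<in> S \<Longrightarrow> f (\<phi> g x) = f x"
    and rep: "\<And>X. X \<in> orbits G S \<phi> \<Longrightarrow> rep X \<in> X"
  shows "(\<Sum>X\<in>orbits G S \<phi>. of_nat (order G) / of_nat (card (stabilizer G \<phi> (rep X))) * f (rep X)) =
    (\<Sum>x\<in>S. f x)"
proof -
  have sub: "X \<subseteq> S" if "X \<in> orbits G S \<phi>" for X
    using that closed by (auto simp: orbits_def orbit_def)
  have union: "\<Union> (orbits G S \<phi>) = S"
  proof
    show "S \<subseteq> \<Union> (orbits G S \<phi>)"
      using orbit_refl S by (auto simp: orbits_def)
  qed (use sub in blast)
  have mono: "orbits G S \<phi> \<subseteq> orbits G E \<phi>"
    using S by (auto simp: orbits_def)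
  have orbit: "of_nat (order G) / of_nat (card (stabilizer G \<phi> (rep X))) * f (rep X) = (\<Sum>x\<in>X. f x)"
    if X: "X \<in> orbits G S \<phi>" for X
  proof -
    have r: "rep X \<in> X" "rep X \<in> S" "rep X \<in> E"
      using rep[OF X] sub[OF X] S by auto
    have "orbit G \<phi> (rep X) \<in> orbits G E \<phi>"
      using r by (auto simp: orbits_def)
    moreover have "rep X \<in> orbit G \<phi> (rep X)"
      using orbit_refl r(3) by blast
    ultimately have X_eq: "X = orbit G \<phi> (rep X)"
      using disjoint_union[of X "orbit G \<phi> (rep X)"] X mono r(1) by blast
    have os: "card X * card (stabilizer G \<phi> (rep X)) = order G"
      using orbit_stabilizer_theorem[OF r(3)] X_eq by simp
    \<comment> \<open>This excludes a stabilizer of cardinality 0, for which the division would not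
      return the orbit size.\<close>
    have "order G \<noteq> 0"
      using fin(1) by (simp add: order_def) (metis empty_iff group_hom group_hom.axioms(1) group.is_monoid monoid.one_closed)
    then have "card (stabilizer G \<phi> (rep X)) \<noteq> 0"
      using os by (metis mult_0_right)
    then have "of_nat (order G) / of_nat (card (stabilizer G \<phi> (rep X))) = (of_nat (card X) :: 'd)"
      by (simp add: os[symmetric])
    moreover have "f x = f (rep X)" if "x \<in> X" for x
    proof -
      have "x \<in> orbit G \<phi> (rep X)" using that X_eq by simp
      then show ?thesis using inv r(2) by (auto simp: orbit_def)
    qed
    ultimately show ?thesis by simp
  qed
  have "(\<Sum>x\<in>\<Union> (orbits G S \<phi>). f x) = (\<Sum>X\<in>orbits G S \<phi>. \<Sum>x\<in>X. f x)"
  proof (rule sum.Union_disjoint[unfolded comp_def])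
    show "\<forall>X\<in>orbits G S \<phi>. finite X" using sub fin(2) finite_subset by blast
    show "\<forall>X\<in>orbits G S \<phi>. \<forall>Y\<in>orbits G S \<phi>. X \<noteq> Y \<longrightarrow> X \<inter> Y = {}"
      using disjoint_union mono by blast
  qed
  then show ?thesis
    using orbit union by simp
qed

lemma order_equiv_group: "order (equiv_group n) = 6 ^ n * fact n"
proof -
  have "card {s. s permutes {Ka, Kb, Kc}} = 6"
    by (subst card_permutations[of _ 3]) (simp_all add: fact_numeral)
  moreover have "card {p. p permutes {1..n}} = fact n"
    by (rule card_permutations) simp_all
  ultimately show ?thesis
    by (simp add: order_def carrier_equiv_group card_cartesian_product card_PiE)
qed

lemma finite_equiv_group: "finite (carrier (equiv_group n))"
  unfolding carrier_equiv_group by (intro finite_cartesian_product finite_PiE) (simp_all add: finite_permutations)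

text \<open>A permutation of a, b, c fixes 0 and is injective, while \<open>klein_dot\<close> and
  the weight depend only on which entries vanish or coincide. Permuting coordinates merely reindexes
  the sums.\<close>

lemma
  assumes g: "g \<in> carrier (equiv_group n)"
  shows isometry_vec_action: "isometry n (vec_action n g)"
    and wt_vec_action: "x \<in> space n \<Longrightarrow> wt n (vec_action n g x) = wt n x"
proof -
  obtain s p where sp: "g = (s, p)" "p permutes {1..n}"
      "\<And>i. i \<in> {1..n} \<Longrightarrow> s i permutes {Ka, Kb, Kc}"
    using g unfolding carrier_equiv_group by (auto simp: PiE_iff)
  define q where "q = Hilbert_Choice.inv p"
  have q: "q permutes {1..n}"
    using sp(2) by (simp add: q_def permutes_inv)
  have act: "vec_action n g x i = s i (x (q i))" if "i \<in> {1..n}" "x \<in> space n" for i x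
    using that by (simp add: vec_action_def sp(1) q_def)
  have inj: "s i t = s i t' \<longleftrightarrow> t = t'" if "i \<in> {1..n}" for i t t'
    using sp(3)[OF that] by (metis permutes_def)
  have K0: "s i K0 = K0" if "i \<in> {1..n}" for i
    using sp(3)[OF that] by (rule permutes_not_in) simp
  have nz: "s i t = K0 \<longleftrightarrow> t = K0" if "i \<in> {1..n}" for i t
    using inj[OF that, of t K0] K0[OF that] by simp
  show "isometry n (vec_action n g)"
  proof (rule isometryI)
    fix x y assume xy: "x \<in> space n" "y \<in> space n"
    have "code_form n (vec_action n g x) (vec_action n g y) = (\<Sum>i\<in>{1..n}. klein_dot (x (q i)) (y (q i)))"
      unfolding code_form_def by (rule sum.cong[OF refl]) (simp only: act xy klein_dot_def inj nz)
    also have "\<dots> = code_form n x y"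
      unfolding code_form_def by (subst (2) sum.permute[OF q]) (simp only: comp_def)
    finally show "code_form n (vec_action n g x) (vec_action n g y) = code_form n x y" .
  qed (rule vec_action_closed)
  show "wt n (vec_action n g x) = wt n x" if x: "x \<in> space n"
  proof -
    have "wt n (vec_action n g x) = (\<Sum>i\<in>{1..n}. if x (q i) \<noteq> K0 then 1 else 0)"
      unfolding wt_eq_sum by (rule sum.cong[OF refl]) (simp only: act x nz)
    also have "\<dots> = wt n x"
      unfolding wt_eq_sum by (subst (2) sum.permute[OF q]) (simp only: comp_def)
    finally show ?thesis .
  qed
qed

text \<open>The group acts by isometries and preserves \<open>Q\<close>, so \<open>codes n Q\<close>
  is stable under it; weights are preserved too, so the weight enumerator is constant on
  orbits.\<close>

lemma sum_equivalence_classes: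
  fixes u v :: "'a :: field_char_0"
  assumes Q: "\<And>g x. g \<in> carrier (equiv_group n) \<Longrightarrow> x \<in> space n \<Longrightarrow> Q (vec_action n g x) \<longleftrightarrow> Q x"
    and rep: "\<And>X. X \<in> equivalence_classes n (codes n Q) \<Longrightarrow> rep X \<in> X"
  shows "(\<Sum>X\<in>equivalence_classes n (codes n Q).
      of_nat (6 ^ n * fact n) / of_nat (card (Aut n (rep X))) * weight_enumerator n (rep X) u v) =
    (\<Sum>C\<in>codes n Q. \<Sum>x\<in>C. u ^ (n - wt n x) * v ^ wt n x)"
proof -
  interpret group_action "equiv_group n" "Pow (space n)" "code_action n"
    by (rule group_action_code_action)
  have act: "code_action n g C = vec_action n g ` C" if "C \<in> codes n Q" for g C
    using subsetD[OF codes_subset that] by (simp add: code_action_def)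
  have closed: "code_action n g C \<in> codes n Q"
    if g: "g \<in> carrier (equiv_group n)" and C: "C \<in> codes n Q" for g C
    using codes_image[OF isometry_vec_action[OF g], where Q = Q and Q' = Q] Q[OF g] C
    unfolding act[OF C] by (auto dest: bij_betwE)
  have inv: "weight_enumerator n (code_action n g C) u v = weight_enumerator n C u v"
    if g: "g \<in> carrier (equiv_group n)" and C: "C \<in> codes n Q" for g C
  proof -
    have sub: "C \<subseteq> space n" using C codes_subset by blast
    have "inj_on (vec_action n g) C"
      using isometry_vec_action[OF g] sub by (auto simp: isometry_def bij_betw_def intro: inj_on_subset)
    moreover have "wt n (vec_action n g x) = wt n x" if "x \<in> C" for x
      using wt_vec_action[OF g] that sub by blast
    ultimately show ?thesis
      by (simp add: act[OF C] weight_enumerator_def sum.reindex)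
  qed
  show ?thesis
    using sum_orbit_representatives[where f = "\<lambda>C. weight_enumerator n C u v",
        OF finite_equiv_group finite_codes codes_subset closed inv rep[unfolded equivalence_classes_def]]
    unfolding equivalence_classes_def Aut_def order_equiv_group by (simp add: weight_enumerator_def)
qed

section \<open>Weight enumerators summed over all codes, without and with the evenness
  condition\<close>

theorem theorem7:
  fixes u v :: "'a :: field_char_0"
  shows
    "(\<forall>n\<ge>1. \<forall>rep. (\<forall>X\<in>equivalence_classes n (self_dual_codes n). rep X \<in> X) \<longrightarrow>
        (\<Sum>X\<in>equivalence_classes n (self_dual_codes n).
           of_nat (6 ^ n * fact n) / of_nat (card (Aut n (rep X))) * weight_enumerator n (rep X) u v)
        = of_nat (mass n) * inverse (1 + 2 ^ n) * (2 ^ n * u ^ n + (u + 3 * v) ^ n))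
   \<and> (\<forall>n\<ge>2. even n \<longrightarrow>
        (\<forall>rep. (\<forall>X\<in>equivalence_classes n (even_self_dual_codes n). rep X \<in> X) \<longrightarrow>
        (\<Sum>X\<in>equivalence_classes n (even_self_dual_codes n).
           of_nat (6 ^ n * fact n) / of_nat (card (Aut n (rep X))) * weight_enumerator n (rep X) u v)
        = of_nat (even_mass n) * inverse (1 + 2 ^ (n - 1)) *
            (2 ^ (n - 1) * u ^ n + 1 / 2 * ((u + 3 * v) ^ n + (u - 3 * v) ^ n))))"
proof (intro conjI allI impI)
  fix n :: nat and rep
  assume "1 \<le> n" and rep: "\<forall>X\<in>equivalence_classes n (self_dual_codes n). rep X \<in> X"
  then obtain k where n: "n = Suc k" by (cases n) auto
  have codes: "self_dual_codes n = codes n (singular 0 n)"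
    by (simp add: codes_def qform_0)
  have "(2::'a) ^ n + 1 \<noteq> 0"
    using of_nat_neq_0[of "2 ^ n", where 'a = 'a] by (simp add: add.commute)
  \<comment> \<open>The quotient is \<open>M(n - 1)\<close>, the number of self-dual codes through a
    given nonzero vector.\<close>
  then have inverse: "of_nat (mass n) * inverse (1 + 2 ^ n) = (of_nat (mass k) :: 'a)"
    by (simp add: n mass_def field_simps)
  have mass: "of_nat (mass n) = (1 + 2 ^ n) * (of_nat (mass k) :: 'a)"
    by (simp add: n mass_def algebra_simps)
  have "(\<Sum>X\<in>equivalence_classes n (self_dual_codes n).
      of_nat (6 ^ n * fact n) / of_nat (card (Aut n (rep X))) * weight_enumerator n (rep X) u v)
    = (\<Sum>C\<in>codes n (singular 0 n). \<Sum>x\<in>C. u ^ (n - wt n x) * v ^ wt n x)"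
    unfolding codes by (rule sum_equivalence_classes) (use rep codes in \<open>auto simp: qform_0\<close>)
  also have "\<dots> = of_nat (mass n) * u ^ n + of_nat (mass k) * ((u + 3 * v) ^ n - u ^ n)"
    using sum_codes[of n "singular 0 n" "mass k" "\<lambda>x. u ^ (n - wt n x) * v ^ wt n x",
        OF card_codes_through[of _ k 0, folded n, unfolded card_codes_symplectic]]
    by (simp only: card_codes_symplectic wt_zero) (simp add: sum_weights qform_0)
  \<comment> \<open>The coefficient of \<open>u ^ n\<close> is
    \<open>mass n - mass k = 2 ^ n * mass k\<close>.\<close>
  also have "\<dots> = of_nat (mass k) * (2 ^ n * u ^ n + (u + 3 * v) ^ n)"
    unfolding mass by (simp add: algebra_simps)
  finally show "(\<Sum>X\<in>equivalence_classes n (self_dual_codes n).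
      of_nat (6 ^ n * fact n) / of_nat (card (Aut n (rep X))) * weight_enumerator n (rep X) u v)
    = of_nat (mass n) * inverse (1 + 2 ^ n) * (2 ^ n * u ^ n + (u + 3 * v) ^ n)"
    unfolding inverse .
next
  fix n :: nat and rep
  assume n2: "2 \<le> n" and "even n"
    and rep: "\<forall>X\<in>equivalence_classes n (even_self_dual_codes n). rep X \<in> X"
  obtain m where m: "n = 2 * m" using \<open>even n\<close> by (rule evenE)
  obtain k where n: "n = Suc k" using n2 by (cases n) simp_all
  \<comment> \<open>The number of even self-dual codes through a given nonzero vector of even
    weight, equal to \<open>M_e(n - 1)\<close>.\<close>
  define c :: nat where "c = (\<Prod>i<k. 2 ^ i + 1)"
  have codes: "even_self_dual_codes n = codes n (\<lambda>x. even (wt n x))"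
    by (simp add: codes_def even_self_dual_codes_def)
  have interval: "{0..n - 1} = {..<n}" using n by auto
  \<comment> \<open>The product defining \<open>even_mass n\<close> ends at the index n - 1 = k,
    whose factor is split off.\<close>
  have even_mass: "even_mass n = (1 + 2 ^ k) * c"
    unfolding even_mass_def interval by (simp add: n c_def)
  have "(2::'a) ^ k + 1 \<noteq> 0"
    using of_nat_neq_0[of "2 ^ k", where 'a = 'a] by (simp add: add.commute)
  then have inverse: "of_nat (even_mass n) * inverse (1 + 2 ^ (n - 1)) = (of_nat c :: 'a)"
    by (simp add: n even_mass[unfolded n] field_simps)
  have card: "card (codes n (\<lambda>x. even (wt n x))) = even_mass n"
    unfolding even_mass_def interval by (rule card_even_codes[of m, folded m])
  have "(\<Sum>X\<in>equivalence_classes n (even_self_dual_codes n).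
      of_nat (6 ^ n * fact n) / of_nat (card (Aut n (rep X))) * weight_enumerator n (rep X) u v)
    = (\<Sum>C\<in>codes n (\<lambda>x. even (wt n x)). \<Sum>x\<in>C. u ^ (n - wt n x) * v ^ wt n x)"
    unfolding codes by (rule sum_equivalence_classes) (use rep codes in \<open>auto simp: wt_vec_action\<close>)
  also have "\<dots> = of_nat (even_mass n) * u ^ n
      + of_nat c * (1 / 2 * ((u + 3 * v) ^ n + (u - 3 * v) ^ n) - u ^ n)"
    using sum_codes[of n "\<lambda>x. even (wt n x)" c "\<lambda>x. u ^ (n - wt n x) * v ^ wt n x",
        OF card_even_codes_through[OF m n, folded c_def]]
    by (simp only: card wt_zero sum_even_weights) simp
  \<comment> \<open>The coefficient of \<open>u ^ n\<close> is
    \<open>(1 + 2 ^ k) * c - c = 2 ^ k * c\<close>.\<close>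
  also have "\<dots> = of_nat c * (2 ^ (n - 1) * u ^ n + 1 / 2 * ((u + 3 * v) ^ n + (u - 3 * v) ^ n))"
    unfolding even_mass using n by (simp add: algebra_simps)
  finally show "(\<Sum>X\<in>equivalence_classes n (even_self_dual_codes n).
      of_nat (6 ^ n * fact n) / of_nat (card (Aut n (rep X))) * weight_enumerator n (rep X) u v)
    = of_nat (even_mass n) * inverse (1 + 2 ^ (n - 1)) *
      (2 ^ (n - 1) * u ^ n + 1 / 2 * ((u + 3 * v) ^ n + (u - 3 * v) ^ n))"
    unfolding inverse .
qed

end
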